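(* There exists a finite connected simple graph $G$ for which $\chi_{\mathrm{g}}(G)<\chi_{\mathrm{cg}}(G)$, where $\chi_{\mathrm{g}}$ is the game chromatic number and $\chi_{\mathrm{cg}}$ is the connected game chromatic number.
   Context: The vertex colouring game on a finite simple graph $G$ with $k$ colours: two players, Maker and Breaker, alternately take turns, with Maker moving first. On each turn the player picks a previously uncoloured vertex and gives it one of the $k$ colours, subject to the rule that no two adjacent vertices may have the same colour. Maker wins if the whole graph is eventually coloured; Breaker wins if at some stage some uncoloured vertex becomes impossible to colour (all $k$ colours appear among its neighbours). The game chromatic number $\chi_{\mathrm{g}}(G)$ is the minimal number of colours $k$ for which Maker has a winning strategy. The connected vertex colouring game on a connected graph $G$ is the same game with the additional rule that, after the first move, a vertex may only be played (by either player) if it is adjacent to a previously coloured vertex. The connected game chromatic number $\chi_{\mathrm{cg}}(G)$ is the minimal number of colours $k$ for which Maker has a winning strategy in the connected vertex colouring game. *)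

theory Defs
  imports "Graph_Theory.Digraph_Component"
begin

text \<open>
  Finite simple graphs are the \<^locale>\<open>pair_graph\<close>s: finite digraphs given by a set of
  arcs (ordered pairs of vertices) that is irreflexive and symmetric.

  A position of a colouring game is the list of moves made so far, oldest first. The colours
  are the natural numbers below \<open>k\<close>.
\<close>

type_synonym 'a move = "'a \<times> nat"

definition coloured :: "'a move list \<Rightarrow> 'a set" where
  "coloured p = fst ` set p"

definition legal_move :: "'a pair_pre_digraph \<Rightarrow> nat \<Rightarrow> 'a move list \<Rightarrow> 'a move \<Rightarrow> bool" where
  "legal_move G k p m \<longleftrightarrow>
     fst m \<in> pverts G \<and> fst m \<notin> coloured p \<and> snd m < k \<and>
     (\<forall>u. (u, fst m) \<in> parcs G \<longrightarrow> (u, snd m) \<notin> set p)"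

definition connected_legal_move ::
    "'a pair_pre_digraph \<Rightarrow> nat \<Rightarrow> 'a move list \<Rightarrow> 'a move \<Rightarrow> bool" where
  "connected_legal_move G k p m \<longleftrightarrow>
     legal_move G k p m \<and> (p \<noteq> [] \<longrightarrow> (\<exists>u\<in>coloured p. (u, fst m) \<in> parcs G))"

definition uncolourable :: "'a pair_pre_digraph \<Rightarrow> nat \<Rightarrow> 'a move list \<Rightarrow> 'a \<Rightarrow> bool" where
  "uncolourable G k p v \<longleftrightarrow>
     v \<in> pverts G \<and> v \<notin> coloured p \<and> (\<forall>c<k. \<exists>u. (u, v) \<in> parcs G \<and> (u, c) \<in> set p)"

text \<open>
  The positions that can arise, under the rules \<open>legal\<close>, when Maker follows the strategy
  \<open>s\<close> and Breaker moves arbitrarily. Maker moves first, hence in the positions of even length.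
  If \<open>s\<close> prescribes an illegal move at a position, that position has no successor.
\<close>

inductive play_following ::
    "('a move list \<Rightarrow> 'a move \<Rightarrow> bool) \<Rightarrow> ('a move list \<Rightarrow> 'a move) \<Rightarrow> 'a move list \<Rightarrow> bool"
  for legal s where
  start: "play_following legal s []"
| maker: "play_following legal s p \<Longrightarrow> even (length p) \<Longrightarrow> legal p (s p) \<Longrightarrow>
    play_following legal s (p @ [s p])"
| breaker: "play_following legal s p \<Longrightarrow> odd (length p) \<Longrightarrow> legal p m \<Longrightarrow>
    play_following legal s (p @ [m])"

text \<open>
  Breaker's winning condition never occurs, and a play can only stop with the whole graph
  coloured. As no vertex is played twice, every play on a finite graph does stop.
\<close>

definition winning_strategy ::
    "'a pair_pre_digraph \<Rightarrow> nat \<Rightarrow> ('a move list \<Rightarrow> 'a move \<Rightarrow> bool) \<Rightarrow>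
     ('a move list \<Rightarrow> 'a move) \<Rightarrow> bool" where
  "winning_strategy G k legal s \<longleftrightarrow>
     (\<forall>p. play_following legal s p \<longrightarrow>
        (\<nexists>v. uncolourable G k p v) \<and>
        ((\<nexists>m. play_following legal s (p @ [m])) \<longrightarrow> coloured p = pverts G))"

text \<open>
  On a finite graph Maker wins both games with more colours than vertices (the connected
  game provided the graph is connected), so the minima below are attained. The connected
  game chromatic number is only meaningful for connected graphs.
\<close>

definition game_chromatic_number :: "'a pair_pre_digraph \<Rightarrow> nat" where
  "game_chromatic_number G = (LEAST k. \<exists>s. winning_strategy G k (legal_move G k) s)"

definition connected_game_chromatic_number :: "'a pair_pre_digraph \<Rightarrow> nat" where
  "connected_game_chromatic_number G =
     (LEAST k. \<exists>s. winning_strategy G k (connected_legal_move G k) s)"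

end

theory Submission
  imports Defs
begin

text \<open>
  The graph that separates the two numbers has nine vertices. A hub \<open>0\<close> is adjacent to
  \<open>1, \<dots>, 7\<close>. The vertices \<open>1, \<dots>, 6\<close> induce the bipartite graph \<open>B\<close> with sides \<open>{1, 2}\<close> and
  \<open>{3, 4, 5, 6}\<close>, complete except for the missing edge between \<open>1\<close> and \<open>6\<close>. The vertex \<open>7\<close> is a
  leaf at the hub. The vertex \<open>8\<close> is adjacent to \<open>3\<close>, \<open>4\<close> and \<open>6\<close>, and it is the only vertex at
  distance two from the hub.

  Consider three colours and suppose that the hub has colour \<open>0\<close>. The vertices of \<open>B\<close> share the
  other two colours, so each side of \<open>B\<close> must end up in a single colour, and what matters is who
  opens \<open>B\<close>. If Breaker does, Maker has an answer that enforces the bipartition. If Maker does,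
  some vertex of \<open>B\<close> is still free to take the wrong colour, and Breaker gives it this colour.
  Both players therefore want to pass, and two passing moves are left: the leaf \<open>7\<close>, and the
  vertex \<open>8\<close> in the colour of the hub.

  In the ordinary game Maker colours the hub and meets each passing move with the other one, so
  that Breaker has to open \<open>B\<close> (\<open>maker_wins_hub_graph\<close>). Hence the game chromatic number is at
  most three. In the connected game Breaker meets the move at the hub with the leaf \<open>7\<close>. Now
  \<open>8\<close> has no coloured neighbour, Maker cannot pass, and has to open \<open>B\<close>. An opening at \<open>7\<close> leads
  to the same position, as Breaker takes the hub. If Maker opens inside \<open>B\<close>, Breaker gives a
  neighbour in \<open>B\<close> another colour. Only the third colour is then left for the hub, and Breaker
  threatens to put it on yet another neighbour of the hub. Maker can only parry by colouring
  the hub, after which \<open>B\<close> still has a vertex free to take the wrong colour. An opening at \<open>8\<close> is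
  beaten by a play of the same kind that is one round longer (\<open>breaker_wins_hub_graph\<close>).

  It remains to exclude fewer than three colours, for which a triangle suffices
  (\<open>triangle_needs_three_colours\<close>), and to see that the minimum defining the connected
  game chromatic number is attained (\<open>connected_game_winnable\<close>).

  Both case analyses are short because most lines end at once: with Breaker making some vertex
  uncolourable, or with Maker reaching a \<^emph>\<open>settled\<close> position, in which adjacent uncoloured
  vertices have no available colour in common. From there on no move can do any harm.
\<close>

section \<open>Winning positions\<close>

text \<open>
  The proposition \<^term>\<open>legal_move G k p (v, c)\<close> says that \<open>v\<close> is uncoloured and that the colour
  \<open>c\<close> is still available to it.
\<close>

definition settled :: "'a pair_pre_digraph \<Rightarrow> nat \<Rightarrow> 'a move list \<Rightarrow> bool" where
  "settled G k p \<longleftrightarrow>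
     (\<forall>v\<in>pverts G - coloured p. \<exists>c. legal_move G k p (v, c)) \<and>
     (\<forall>(u, v)\<in>parcs G. \<forall>c. \<not> (legal_move G k p (u, c) \<and> legal_move G k p (v, c)))"

text \<open>
  The existence of a legal move in the clause for Breaker ensures that a position without legal
  moves is won for Maker only if it is settled, that is, completely coloured.
\<close>

inductive maker_wins :: "'a pair_pre_digraph \<Rightarrow> nat \<Rightarrow> 'a move list \<Rightarrow> bool" for G k where
  settled: "settled G k p \<Longrightarrow> maker_wins G k p"
| maker: "even (length p) \<Longrightarrow> legal_move G k p m \<Longrightarrow> maker_wins G k (p @ [m]) \<Longrightarrow>
    maker_wins G k p"
| breaker: "odd (length p) \<Longrightarrow> legal_move G k p m\<^sub>0 \<Longrightarrow>
    (\<And>m. legal_move G k p m \<Longrightarrow> maker_wins G k (p @ [m])) \<Longrightarrow> maker_wins G k p"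

text \<open>
  In the clause for Maker, the legal move \<open>m\<^sub>0\<close> witnesses that some vertex is still uncoloured.
  A strategy of Maker that prescribes an illegal move there ends the play prematurely, which also
  counts as a loss for Maker.
\<close>

inductive breaker_wins ::
    "'a pair_pre_digraph \<Rightarrow> nat \<Rightarrow> ('a move list \<Rightarrow> 'a move \<Rightarrow> bool) \<Rightarrow> 'a move list \<Rightarrow> bool"
  for G k legal where
  stuck: "uncolourable G k p v \<Longrightarrow> breaker_wins G k legal p"
| breaker: "odd (length p) \<Longrightarrow> legal p m \<Longrightarrow> breaker_wins G k legal (p @ [m]) \<Longrightarrow>
    breaker_wins G k legal p"
| maker: "even (length p) \<Longrightarrow> legal p m\<^sub>0 \<Longrightarrow>
    (\<And>m. legal p m \<Longrightarrow> breaker_wins G k legal (p @ [m])) \<Longrightarrow> breaker_wins G k legal p"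

lemma coloured_Nil [simp]: "coloured [] = {}"
  by (simp add: coloured_def)

lemma coloured_snoc [simp]: "coloured (p @ [m]) = insert (fst m) (coloured p)"
  by (simp add: coloured_def)

lemma legal_moveD:
  assumes "legal_move G k p m"
  shows "fst m \<in> pverts G" "fst m \<notin> coloured p" "snd m < k"
  using assms by (auto simp: legal_move_def)

lemma legal_move_iff_not_uncolourable:
  "v \<in> pverts G - coloured p \<Longrightarrow> (\<exists>c. legal_move G k p (v, c)) \<longleftrightarrow> \<not> uncolourable G k p v"
  by (auto simp: legal_move_def uncolourable_def)

lemma play_following_snoc_iff:
  "play_following legal s (p @ [m]) \<longleftrightarrow>
     play_following legal s p \<and> legal p m \<and> (even (length p) \<longrightarrow> m = s p)"
  by (auto elim: play_following.cases intro: play_following.intros)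

lemma breaker_wins_imp_not_winning_strategy:
  assumes "breaker_wins G k legal p" "play_following legal s p"
    and legal: "\<And>p m. legal p m \<Longrightarrow> legal_move G k p m"
  shows "\<not> winning_strategy G k legal s"
  using assms(1,2)
proof (induction rule: breaker_wins.induct)
  case (stuck p v)
  then show ?case by (auto simp: winning_strategy_def)
next
  case (breaker p m)
  then show ?case by (simp add: play_following_snoc_iff)
next
  case (maker p m\<^sub>0)
  show ?case
  proof (cases "legal p (s p)")
    case True
    with maker show ?thesis by (simp add: play_following_snoc_iff)
  next
    case False
    then have "\<nexists>m. play_following legal s (p @ [m])"
      using maker.hyps(1) by (auto simp: play_following_snoc_iff)
    moreover have "coloured p \<noteq> pverts G"
      using legal[OF maker.hyps(2)] by (auto dest: legal_moveD)
    ultimately show ?thesis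
      using maker.prems by (auto simp: winning_strategy_def)
  qed
qed

text \<open>
  Maker wins by maintaining an invariant: the strategy picks any move that preserves it.
\<close>

lemma winning_strategyI:
  assumes init: "I []"
    and maker: "\<And>p. I p \<Longrightarrow> even (length p) \<Longrightarrow> coloured p \<noteq> pverts G \<Longrightarrow>
      \<exists>m. legal p m \<and> I (p @ [m])"
    and breaker: "\<And>p m. I p \<Longrightarrow> odd (length p) \<Longrightarrow> legal p m \<Longrightarrow> I (p @ [m])"
    and move: "\<And>p. I p \<Longrightarrow> odd (length p) \<Longrightarrow> coloured p \<noteq> pverts G \<Longrightarrow> \<exists>m. legal p m"
    and safe: "\<And>p v. I p \<Longrightarrow> \<not> uncolourable G k p v"
    and legal: "\<And>p m. legal p m \<Longrightarrow> legal_move G k p m"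
  shows "\<exists>s. winning_strategy G k legal s"
proof -
  define s where "s p = (SOME m. legal p m \<and> I (p @ [m]))" for p
  have s: "legal p (s p) \<and> I (p @ [s p])"
    if "I p" "even (length p)" "coloured p \<noteq> pverts G" for p
    unfolding s_def using maker[OF that] by (rule someI_ex)
  have I: "I p" if "play_following legal s p" for p
    using that
  proof induction
    case (maker p)
    have "coloured p \<noteq> pverts G"
      using legal[OF maker.hyps(3)] by (auto dest: legal_moveD)
    then show ?case using s maker by blast
  qed (use init breaker in auto)
  have "winning_strategy G k legal s"
    unfolding winning_strategy_def
  proof (intro allI impI conjI)
    fix p assume p: "play_following legal s p"
    show "\<nexists>v. uncolourable G k p v" using safe I[OF p] by blast
    assume over: "\<nexists>m. play_following legal s (p @ [m])"
    show "coloured p = pverts G"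
    proof (rule ccontr)
      assume "coloured p \<noteq> pverts G"
      then have "\<exists>m. legal p m \<and> (even (length p) \<longrightarrow> m = s p)"
        using s[OF I[OF p]] move[OF I[OF p]] by (cases "even (length p)") blast+
      with over p show False by (simp only: play_following_snoc_iff) blast
    qed
  qed
  then show ?thesis by blast
qed

text \<open>
  A move \<open>(u, c)\<close> takes the colour \<open>c\<close> away from the neighbours of \<open>u\<close>. As \<open>c\<close> was available to \<open>u\<close>,
  it was not available to them anyway.
\<close>

lemma settled_snoc:
  assumes "settled G k p" and legal: "legal_move G k p m"
  shows "settled G k (p @ [m])"
proof -
  have free: "\<exists>c. legal_move G k p (v, c)" if "v \<in> pverts G - coloured p" for v
    using assms(1) that by (auto simp: settled_def)
  have apart: "\<not> (legal_move G k p (u, c) \<and> legal_move G k p (v, c))"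
    if "(u, v) \<in> parcs G" for u v c
    using assms(1) that by (auto simp: settled_def)
  have "\<exists>c. legal_move G k (p @ [m]) (v, c)" if v: "v \<in> pverts G - coloured (p @ [m])" for v
  proof -
    obtain c where c: "legal_move G k p (v, c)" using free v by auto
    have "\<not> ((fst m, v) \<in> parcs G \<and> c = snd m)"
      using apart[of "fst m" v c] legal c by auto
    with c v have "legal_move G k (p @ [m]) (v, c)"
      by (cases m) (auto simp: legal_move_def)
    then show ?thesis ..
  qed
  moreover have "legal_move G k p x" if "legal_move G k (p @ [m]) x" for x
    using that by (auto simp: legal_move_def)
  ultimately show ?thesis
    using apart unfolding settled_def by blast
qed

lemma uncolourable_snoc:
  "uncolourable G k p v \<Longrightarrow> legal_move G k p m \<Longrightarrow> uncolourable G k (p @ [m]) v"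
  by (cases m) (auto simp: uncolourable_def legal_move_def)

lemma maker_wins_imp_not_uncolourable:
  "maker_wins G k p \<Longrightarrow> \<not> uncolourable G k p v"
proof (induction rule: maker_wins.induct)
  case (settled p)
  show ?case
  proof
    assume v: "uncolourable G k p v"
    then have "v \<in> pverts G - coloured p" by (simp add: uncolourable_def)
    with settled v legal_move_iff_not_uncolourable[of v G p k] show False
      by (auto simp: settled_def)
  qed
next
  case (maker p m)
  then show ?case using uncolourable_snoc by metis
next
  case (breaker p m\<^sub>0)
  then show ?case using uncolourable_snoc by metis
qed

text \<open>
  Being won for Maker is itself an invariant that Maker can maintain.
\<close>

lemma maker_wins_imp_winning_strategy:
  assumes "maker_wins G k []"
  shows "\<exists>s. winning_strategy G k (legal_move G k) s"
proof (rule winning_strategyI[where I = "\<lambda>p. maker_wins G k p \<and> coloured p \<subseteq> pverts G"])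
  show "maker_wins G k [] \<and> coloured [] \<subseteq> pverts G" using assms by simp
next
  fix p assume p: "maker_wins G k p \<and> coloured p \<subseteq> pverts G" and "coloured p \<noteq> pverts G"
  then obtain v where v: "v \<in> pverts G - coloured p" by blast
  then obtain c where c: "legal_move G k p (v, c)"
    using p maker_wins_imp_not_uncolourable legal_move_iff_not_uncolourable by metis
  then show "\<exists>m. legal_move G k p m" ..
  assume even: "even (length p)"
  have "\<exists>m. legal_move G k p m \<and> maker_wins G k (p @ [m])"
    using p[THEN conjunct1]
  proof cases
    case settled
    then show ?thesis using c settled_snoc maker_wins.settled by blast
  qed (use even in blast)+
  with p show "\<exists>m. legal_move G k p m \<and> maker_wins G k (p @ [m]) \<and>
      coloured (p @ [m]) \<subseteq> pverts G"
    by (fastforce dest: legal_moveD)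
next
  fix p m assume "maker_wins G k p \<and> coloured p \<subseteq> pverts G" "odd (length p)" "legal_move G k p m"
  then show "maker_wins G k (p @ [m]) \<and> coloured (p @ [m]) \<subseteq> pverts G"
    by (auto elim!: maker_wins.cases[of G k p] intro: maker_wins.settled settled_snoc
        dest: legal_moveD)
qed (auto dest: maker_wins_imp_not_uncolourable)

section \<open>Bounds on the connected game chromatic number\<close>

lemma connected_imp_cut_arc:
  assumes "pair_graph G" "connected G"
    and "S \<subseteq> pverts G" "S \<noteq> {}" "S \<noteq> pverts G"
  shows "\<exists>u\<in>S. \<exists>v\<in>pverts G - S. (u, v) \<in> parcs G"
proof (rule ccontr)
  interpret pair_graph G by fact
  assume none: "\<not> ?thesis"
  obtain a b where a: "a \<in> S" and b: "b \<in> pverts G - S" using assms by blast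
  have "a \<rightarrow>\<^sup>*\<^bsub>mk_symmetric G\<^esub> b"
    using assms(2) a b assms(3) by (auto simp: connected_def strongly_connected_def)
  then have "a \<rightarrow>\<^sup>*\<^bsub>G\<^esub> b"
    by (simp only: reachable_mk_symmetric_eq[OF pair_sym_arcs])
  then have "b \<in> S"
  proof (induction rule: reachable_induct)
    case (step x y)
    with none show ?case by (auto dest: in_arcsD2)
  qed (use a in simp)
  with b show False by simp
qed

lemma connected_legal_move_exists:
  assumes "pair_graph G" "connected G"
    and "coloured p \<subseteq> pverts G" "coloured p \<noteq> pverts G"
    and "\<And>v. \<not> uncolourable G k p v"
  shows "\<exists>m. connected_legal_move G k p m"
proof -
  obtain v where v: "v \<in> pverts G - coloured p" "p \<noteq> [] \<longrightarrow> (\<exists>u\<in>coloured p. (u, v) \<in> parcs G)"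
  proof (cases "p = []")
    case False
    then have "coloured p \<noteq> {}" by (simp add: coloured_def)
    with connected_imp_cut_arc[OF assms(1,2,3)] assms(4) that show ?thesis by blast
  qed (use assms(3,4) that in blast)
  then obtain c where "legal_move G k p (v, c)"
    using assms(5) legal_move_iff_not_uncolourable by metis
  with v show ?thesis by (auto simp: connected_legal_move_def)
qed

text \<open>
  With as many colours as vertices, an uncoloured vertex never sees all colours. Connectivity of
  the graph provides a legal move as long as some vertex is uncoloured.
\<close>

lemma connected_game_winnable:
  assumes "pair_graph G" "connected G"
  shows "\<exists>s. winning_strategy G (card (pverts G)) (connected_legal_move G (card (pverts G))) s"
proof -
  let ?n = "card (pverts G)"
  let ?I = "\<lambda>p. distinct (map fst p) \<and> coloured p \<subseteq> pverts G"
  interpret pair_graph G by fact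
  have safe: "\<not> uncolourable G ?n p v" if "?I p" for p v
  proof
    assume v: "uncolourable G ?n p v"
    have "coloured p \<subset> pverts G" using v that by (auto simp: uncolourable_def)
    then have "card (coloured p) < ?n" by (simp add: psubset_card_mono)
    moreover have "card (coloured p) = length p"
      using distinct_card[of "map fst p"] that by (simp add: coloured_def)
    moreover have "{..<?n} \<subseteq> snd ` set p" using v by (force simp: uncolourable_def)
    then have "?n \<le> card (snd ` set p)" using card_mono[of "snd ` set p" "{..<?n}"] by simp
    moreover have "card (snd ` set p) \<le> length p"
      using card_image_le[of "set p" snd] card_length[of p] by simp
    ultimately show False by simp
  qed
  have legal: "legal_move G k p m" if "connected_legal_move G k p m" for k p m
    using that by (simp add: connected_legal_move_def)
  have step: "?I (p @ [m])" if "?I p" "connected_legal_move G ?n p m" for p m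
    using that(1) legal_moveD[OF legal[OF that(2)]] by (auto simp: coloured_def)
  have move: "\<exists>m. connected_legal_move G ?n p m" if "?I p" "coloured p \<noteq> pverts G" for p
    using connected_legal_move_exists[OF assms] that safe by blast
  show ?thesis
  proof (rule winning_strategyI[where I = ?I])
    fix p assume "?I p" "coloured p \<noteq> pverts G"
    then obtain m where "connected_legal_move G ?n p m" using move by blast
    with \<open>?I p\<close> step show "\<exists>m. connected_legal_move G ?n p m \<and> ?I (p @ [m])" by blast
  qed (use safe legal step move in \<open>simp; fail | blast\<close>)+
qed

text \<open>
  A play in which not everything is coloured can be prolonged, but no play is longer than the
  number of vertices.
\<close>

lemma winning_strategy_imp_complete_play:
  assumes "finite (pverts G)" "winning_strategy G k legal s"
    and legal: "\<And>p m. legal p m \<Longrightarrow> legal_move G k p m"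
  shows "\<exists>p. play_following legal s p \<and> coloured p = pverts G"
proof (rule ccontr)
  assume "\<not> ?thesis"
  then have more: "\<exists>m. play_following legal s (p @ [m])" if "play_following legal s p" for p
    using assms(2) that unfolding winning_strategy_def by blast
  have "\<exists>p. play_following legal s p \<and> length p = n" for n
  proof (induction n)
    case 0
    then show ?case by (auto intro: play_following.start)
  next
    case (Suc n)
    then show ?case using more by (metis length_append_singleton)
  qed
  then obtain p where p: "play_following legal s p" "length p = Suc (card (pverts G))" by blast
  from p(1) have "distinct (map fst p) \<and> coloured p \<subseteq> pverts G"
    by induction (use legal_moveD(1,2)[OF legal] in \<open>auto simp: coloured_def\<close>)
  then have "length p \<le> card (pverts G)"
    using assms(1) distinct_card[of "map fst p"] card_mono[of "pverts G" "coloured p"]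
    by (simp add: coloured_def)
  with p(2) show False by simp
qed

lemma winning_strategy_imp_proper_colouring:
  assumes "pair_graph G" "winning_strategy G k legal s"
    and legal: "\<And>p m. legal p m \<Longrightarrow> legal_move G k p m"
  obtains f where "\<And>v. v \<in> pverts G \<Longrightarrow> f v < k" "\<And>u v. (u, v) \<in> parcs G \<Longrightarrow> f u \<noteq> f v"
proof -
  interpret pair_graph G by fact
  obtain p where p: "play_following legal s p" "coloured p = pverts G"
    using winning_strategy_imp_complete_play[OF pair_finite_verts assms(2) legal] by blast
  have snoc: "(\<forall>x\<in>set (p @ [m]). snd x < k) \<and>
      (\<forall>x\<in>set (p @ [m]). \<forall>y\<in>set (p @ [m]). (fst x, fst y) \<in> parcs G \<longrightarrow> snd x \<noteq> snd y)"
    if IH: "(\<forall>x\<in>set p. snd x < k) \<and>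
      (\<forall>x\<in>set p. \<forall>y\<in>set p. (fst x, fst y) \<in> parcs G \<longrightarrow> snd x \<noteq> snd y)"
      and m: "legal_move G k p m" for p m
  proof -
    have new: "snd x \<noteq> snd m" if "x \<in> set p" "(fst x, fst m) \<in> parcs G" for x
      using m that by (cases x) (auto simp: legal_move_def)
    have "snd m \<noteq> snd x" if "x \<in> set p" "(fst m, fst x) \<in> parcs G" for x
      using new[OF that(1)] that(2) arcs_symmetric by metis
    moreover have "(fst m, fst m) \<notin> parcs G" using pair_no_loops by fastforce
    ultimately show ?thesis using IH new legal_moveD(3)[OF m] by auto
  qed
  have proper: "(\<forall>x\<in>set p. snd x < k) \<and>
      (\<forall>x\<in>set p. \<forall>y\<in>set p. (fst x, fst y) \<in> parcs G \<longrightarrow> snd x \<noteq> snd y)"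
    using p(1)
  proof induction
    case start
    show ?case by simp
  next
    case (maker p)
    then show ?case using snoc legal by blast
  next
    case (breaker p m)
    then show ?case using snoc legal by blast
  qed
  define f where "f v = (SOME c. (v, c) \<in> set p)" for v
  have f: "(v, f v) \<in> set p" if "v \<in> pverts G" for v
  proof -
    have "\<exists>c. (v, c) \<in> set p" using that p(2) by (force simp: coloured_def)
    then show ?thesis unfolding f_def by (rule someI_ex)
  qed
  show ?thesis
  proof (rule that)
    show "f v < k" if "v \<in> pverts G" for v using f[OF that] proper by fastforce
    show "f u \<noteq> f v" if "(u, v) \<in> parcs G" for u v
      using f[OF in_arcsD1[OF that]] f[OF in_arcsD2[OF that]] that proper by fastforce
  qed
qed

text \<open>
  The final position of a won play is a proper colouring, so the chromatic number bounds the
  number of colours from below.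
\<close>

lemma triangle_needs_three_colours:
  assumes "pair_graph G" "winning_strategy G k legal s"
    and "\<And>p m. legal p m \<Longrightarrow> legal_move G k p m"
    and "(x, y) \<in> parcs G" "(y, z) \<in> parcs G" "(x, z) \<in> parcs G"
  shows "3 \<le> k"
proof -
  interpret pair_graph G by fact
  obtain f where f: "\<And>v. v \<in> pverts G \<Longrightarrow> f v < k" "\<And>u v. (u, v) \<in> parcs G \<Longrightarrow> f u \<noteq> f v"
    using winning_strategy_imp_proper_colouring[OF assms(1-3)] by blast
  have "x \<in> pverts G" "y \<in> pverts G" "z \<in> pverts G"
    using assms(4-6) in_arcsD1 in_arcsD2 by auto
  then show ?thesis
    using f(1)[of x] f(1)[of y] f(1)[of z] f(2)[OF assms(4)] f(2)[OF assms(5)] f(2)[OF assms(6)]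
    by linarith
qed

section \<open>A graph with a hub and a vertex out of its reach\<close>

definition neighbours :: "nat \<Rightarrow> nat list" where
  "neighbours v =
     [[1, 2, 3, 4, 5, 6, 7],
      [0, 3, 4, 5],
      [0, 3, 4, 5, 6],
      [0, 1, 2, 8],
      [0, 1, 2, 8],
      [0, 1, 2],
      [0, 2, 8],
      [0],
      [3, 4, 6]] ! v"

definition hub_graph :: "nat pair_pre_digraph" where
  "hub_graph = \<lparr>pverts = {0..<9}, parcs = {(u, v). v < 9 \<and> u \<in> set (neighbours v)}\<rparr>"

lemma hub_graph_simps [simp]:
  "pverts hub_graph = {0..<9}"
  "(u, v) \<in> parcs hub_graph \<longleftrightarrow> v < 9 \<and> u \<in> set (neighbours v)"
  by (simp_all add: hub_graph_def)

lemma neighbours_symmetric: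
  assumes "v < 9" "u \<in> set (neighbours v)"
  shows "u < 9" "u \<noteq> v" "v \<in> set (neighbours u)"
proof -
  have "list_all (\<lambda>v. list_all (\<lambda>u. u < 9 \<and> u \<noteq> v \<and> v \<in> set (neighbours u))
      (neighbours v)) [0..<9]"
    by code_simp
  then have "\<forall>v\<in>{0..<9}. \<forall>u\<in>set (neighbours v). u < 9 \<and> u \<noteq> v \<and> v \<in> set (neighbours u)"
    by (simp only: list_all_iff set_upt)
  from bspec[OF bspec[OF this, of v], of u] assms
  have "u < 9 \<and> u \<noteq> v \<and> v \<in> set (neighbours u)" by simp
  then show "u < 9" "u \<noteq> v" "v \<in> set (neighbours u)" by simp_all
qed

lemma pair_graph_hub_graph: "pair_graph hub_graph"
proof
  show "finite (parcs hub_graph)"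
    by (rule finite_subset[of _ "{0..<9} \<times> {0..<9}"]) (auto intro: neighbours_symmetric)
  show "symmetric hub_graph"
    by (auto simp: symmetric_def sym_def intro: neighbours_symmetric)
qed (auto intro: neighbours_symmetric dest: neighbours_symmetric(2))

lemma connected_hub_graph: "connected hub_graph"
proof -
  interpret pair_graph hub_graph by (rule pair_graph_hub_graph)
  \<comment> \<open>The walk to \<open>8\<close> leads through \<open>3\<close>.\<close>
  have "list_all (\<lambda>v. v = 0 \<or> 0 \<in> set (neighbours v) \<or> 3 \<in> set (neighbours v)) [0..<9]"
    by code_simp
  then have "\<forall>v\<in>{0..<9}. v = 0 \<or> 0 \<in> set (neighbours v) \<or> 3 \<in> set (neighbours v)"
    by (simp only: list_all_iff set_upt)
  then have near: "v = 0 \<or> (0, v) \<in> parcs hub_graph \<or> (3, v) \<in> parcs hub_graph" if "v < 9" for v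
    using that by auto
  have "(0, 3) \<in> parcs hub_graph" by (simp add: neighbours_def)
  then have "0 \<rightarrow>\<^sup>*\<^bsub>hub_graph\<^esub> 3" by (rule reachable_adjI)
  then have hub: "0 \<rightarrow>\<^sup>*\<^bsub>hub_graph\<^esub> v" if "v < 9" for v
    using near[OF that]
    by (auto intro: reachable_adjI reachable_trans[OF _ reachable_adjI] simp del: hub_graph_simps(2))
  have "u \<rightarrow>\<^sup>*\<^bsub>mk_symmetric hub_graph\<^esub> v" if "u < 9" "v < 9" for u v
    by (intro reachable_mk_symmetricI reachable_trans[of u 0 v] hub that
        symmetric_reachable[OF pair_sym_arcs])
  then show ?thesis
    by (auto simp: connected_def strongly_connected_def)
qed

text \<open>
  Executable versions of the notions above, for \<^const>\<open>hub_graph\<close> and three colours.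
\<close>

definition moves :: "nat move list \<Rightarrow> nat move list" where
  "moves p = [(v, c). v \<leftarrow> [0..<9], v \<notin> fst ` set p, c \<leftarrow> [0..<3],
     list_all (\<lambda>u. (u, c) \<notin> set p) (neighbours v)]"

definition connected_moves :: "nat move list \<Rightarrow> nat move list" where
  "connected_moves p =
     filter (\<lambda>m. p = [] \<or> list_ex (\<lambda>u. u \<in> fst ` set p) (neighbours (fst m))) (moves p)"

definition is_stuck :: "nat move list \<Rightarrow> bool" where
  "is_stuck p \<longleftrightarrow> list_ex (\<lambda>v. v \<notin> fst ` set p \<and>
     list_all (\<lambda>c. list_ex (\<lambda>u. (u, c) \<in> set p) (neighbours v)) [0..<3]) [0..<9]"

definition is_settled :: "nat move list \<Rightarrow> bool" where
  "is_settled p \<longleftrightarrow> \<not> is_stuck p \<and>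
     list_all (\<lambda>(v, c). list_all (\<lambda>u. (u, c) \<notin> set (moves p)) (neighbours v)) (moves p)"

text \<open>
  In a trapped position it is Maker's turn in the connected game, and Breaker wins within \<open>n\<close> moves
  of his own. Immediate kills appear as a separate alternative because they end the game before
  the \<open>n\<close> moves are used up.
\<close>

fun trapped :: "nat \<Rightarrow> nat move list \<Rightarrow> bool" where
  "trapped 0 p \<longleftrightarrow> is_stuck p"
| "trapped (Suc n) p \<longleftrightarrow> connected_moves p \<noteq> [] \<and>
     list_all (\<lambda>m. is_stuck (p @ [m]) \<or>
       list_ex (\<lambda>m'. is_stuck (p @ [m, m'])) (connected_moves (p @ [m])) \<or>
       list_ex (\<lambda>m'. trapped n (p @ [m, m'])) (connected_moves (p @ [m])))
     (connected_moves p)"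

lemma in_moves_iff: "m \<in> set (moves p) \<longleftrightarrow> legal_move hub_graph 3 p m"
  by (cases m) (auto simp: moves_def legal_move_def coloured_def list_all_iff)

lemma in_connected_moves_iff:
  "m \<in> set (connected_moves p) \<longleftrightarrow> connected_legal_move hub_graph 3 p m"
  by (auto simp: connected_moves_def connected_legal_move_def in_moves_iff list_ex_iff coloured_def
      dest: legal_moveD)

lemma is_stuck_iff: "is_stuck p \<longleftrightarrow> (\<exists>v. uncolourable hub_graph 3 p v)"
  by (auto simp: is_stuck_def uncolourable_def list_ex_iff list_all_iff coloured_def Ball_def Bex_def)

lemma is_settled_imp_settled:
  assumes "is_settled p"
  shows "settled hub_graph 3 p"
  unfolding settled_def
proof (intro conjI ballI)
  fix v assume "v \<in> pverts hub_graph - coloured p"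
  moreover have "\<not> uncolourable hub_graph 3 p v"
    using assms by (simp add: is_settled_def is_stuck_iff)
  ultimately show "\<exists>c. legal_move hub_graph 3 p (v, c)"
    using legal_move_iff_not_uncolourable by metis
next
  fix e assume "e \<in> parcs hub_graph"
  moreover have "(u, c) \<notin> set (moves p)" if "(v, c) \<in> set (moves p)" "u \<in> set (neighbours v)" for u v c
    using assms that by (auto simp: is_settled_def list_all_iff)
  ultimately show "case e of (u, v) \<Rightarrow>
      \<forall>c. \<not> (legal_move hub_graph 3 p (u, c) \<and> legal_move hub_graph 3 p (v, c))"
    by (cases e) (auto simp: in_moves_iff)
qed

section \<open>Maker wins the ordinary game with three colours\<close>

text \<open>
  Maker's answer to a move at \<open>v\<close> is looked up at index \<open>v\<close> of the list. When the hub has colour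
  \<open>0\<close>, the two colours of \<open>B\<close> are \<open>1\<close> and \<open>2\<close>, and \<open>3 - c\<close> is the other one.
\<close>

definition answered_by :: "nat list \<Rightarrow> nat move list \<Rightarrow> nat move \<Rightarrow> bool" where
  "answered_by ws p m \<longleftrightarrow> (let m' = (ws ! fst m, 3 - snd m) in
     m' \<in> set (moves (p @ [m])) \<and> is_settled (p @ [m, m']))"

lemma answered_byD:
  "answered_by ws p m \<Longrightarrow> \<exists>m'\<in>set (moves (p @ [m])). maker_wins hub_graph 3 (p @ [m, m'])"
  by (auto simp: answered_by_def Let_def intro: maker_wins.settled is_settled_imp_settled)

text \<open>
  Each answer leaves a single colour to either side of \<open>B\<close>. It also prevents \<open>8\<close> from taking the
  colour left to \<open>{3, 4, 5, 6}\<close> while a neighbour of \<open>8\<close> still needs it: for this reason the answer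
  to \<open>5\<close>, which is not adjacent to \<open>8\<close>, is \<open>8\<close> itself in the colour left to \<open>{1, 2}\<close>. The entries
  at the indices \<open>0\<close> and \<open>7\<close> are fillers.
\<close>

lemma answers_after_hub:
  "list_all (\<lambda>m. fst m = 7 \<or> m = (8, 0) \<or> answered_by [0, 6, 3, 2, 2, 8, 1, 0, 5] [(0, 0)] m)
     (moves [(0, 0)])"
  by code_simp

text \<open>
  Both passing moves have been made, and \<open>8\<close> has the colour of the hub. It no longer affects \<open>B\<close>, so
  that \<open>5\<close> can be answered inside \<open>B\<close>.
\<close>

lemma answers_after_waiting_moves:
  "list_all (\<lambda>p. list_all (answered_by [0, 6, 3, 2, 2, 2, 1] p) (moves p))
     [[(0, 0), (8, 0), (7, 1)], [(0, 0), (7, 1), (8, 0)], [(0, 0), (7, 2), (8, 0)]]"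
  by code_simp

lemma maker_wins_answer:
  assumes "odd (length p)" "legal_move hub_graph 3 p m\<^sub>0"
    and "\<And>m. m \<in> set (moves p) \<Longrightarrow> \<exists>m'\<in>set (moves (p @ [m])). maker_wins hub_graph 3 (p @ [m, m'])"
  shows "maker_wins hub_graph 3 p"
proof (rule maker_wins.breaker[OF assms(1,2)])
  fix m assume "legal_move hub_graph 3 p m"
  then obtain m' where "legal_move hub_graph 3 (p @ [m]) m'" "maker_wins hub_graph 3 (p @ [m, m'])"
    using assms(3)[of m] in_moves_iff by blast
  then show "maker_wins hub_graph 3 (p @ [m])"
    using maker_wins.maker[of "p @ [m]"] assms(1) by simp
qed

lemma maker_wins_hub_graph: "maker_wins hub_graph 3 []"
proof -
  have second: "maker_wins hub_graph 3 p"
    if p: "p \<in> {[(0, 0), (8, 0), (7, 1)], [(0, 0), (7, 1), (8, 0)], [(0, 0), (7, 2), (8, 0)]}" for p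
  proof (rule maker_wins_answer)
    show "odd (length p)" using p by auto
    show "legal_move hub_graph 3 p (1, 1)"
      using p by (auto simp: legal_move_def coloured_def neighbours_def)
    fix m assume "m \<in> set (moves p)"
    then have "answered_by [0, 6, 3, 2, 2, 2, 1] p m"
      using answers_after_waiting_moves p unfolding list_all_iff list.set by blast
    then show "\<exists>m'\<in>set (moves (p @ [m])). maker_wins hub_graph 3 (p @ [m, m'])"
      by (rule answered_byD)
  qed
  have "maker_wins hub_graph 3 [(0, 0)]"
  proof (rule maker_wins_answer)
    show "legal_move hub_graph 3 [(0, 0)] (1, 1)"
      by (auto simp: legal_move_def coloured_def neighbours_def)
    \<comment> \<open>The passing moves are met with one another; everything else is answered from the table.\<close>
    fix m assume m: "m \<in> set (moves [(0, 0)])"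
    obtain v c where m_eq: "m = (v, c)" by (cases m)
    with m have "c < 3" "v = 7 \<Longrightarrow> c \<noteq> 0"
      by (auto simp: in_moves_iff legal_move_def neighbours_def)
    moreover from \<open>c < 3\<close> have "c = 0 \<or> c = 1 \<or> c = 2" by linarith
    ultimately consider "m \<in> {(7, 1), (7, 2)}" | "m = (8, 0)" | "fst m \<noteq> 7" "m \<noteq> (8, 0)"
      by (cases "v = 7") (auto simp: m_eq)
    then show "\<exists>m'\<in>set (moves ([(0, 0)] @ [m])). maker_wins hub_graph 3 ([(0, 0)] @ [m, m'])"
    proof cases
      case 1
      then have "legal_move hub_graph 3 ([(0, 0)] @ [m]) (8, 0)"
        by (auto simp: legal_move_def coloured_def neighbours_def)
      moreover have "maker_wins hub_graph 3 ([(0, 0)] @ [m, (8, 0)])"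
        by (rule second) (use 1 in auto)
      ultimately show ?thesis using in_moves_iff by blast
    next
      case 2
      then have "legal_move hub_graph 3 ([(0, 0)] @ [m]) (7, 1)"
        by (auto simp: legal_move_def coloured_def neighbours_def)
      moreover have "maker_wins hub_graph 3 ([(0, 0)] @ [m, (7, 1)])"
        by (rule second) (use 2 in auto)
      ultimately show ?thesis using in_moves_iff by blast
    next
      case 3
      then have "answered_by [0, 6, 3, 2, 2, 8, 1, 0, 5] [(0, 0)] m"
        using answers_after_hub m unfolding list_all_iff by blast
      then show ?thesis by (rule answered_byD)
    qed
  qed simp
  moreover have "legal_move hub_graph 3 [] (0, 0)" by (simp add: legal_move_def)
  ultimately show ?thesis using maker_wins.maker[of "[]" hub_graph 3 "(0, 0)"] by simp
qed

section \<open>Breaker wins the connected game with three colours\<close>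

abbreviation "breaker_wins_connected \<equiv>
  breaker_wins hub_graph 3 (connected_legal_move hub_graph 3)"

lemma breaker_reply:
  assumes "odd (length p)" "m \<in> set (connected_moves p)" "breaker_wins_connected (p @ [m])"
  shows "breaker_wins_connected p"
  using assms by (auto simp: in_connected_moves_iff intro: breaker_wins.breaker)

lemma is_stuck_imp_breaker_wins: "is_stuck p \<Longrightarrow> breaker_wins_connected p"
  by (auto simp: is_stuck_iff intro: breaker_wins.stuck)

lemma trapped_imp_breaker_wins:
  "trapped n p \<Longrightarrow> even (length p) \<Longrightarrow> breaker_wins_connected p"
proof (induction n p rule: trapped.induct)
  case (1 p)
  then show ?case by (simp add: is_stuck_imp_breaker_wins)
next
  case (2 n p)
  obtain m\<^sub>0 where "m\<^sub>0 \<in> set (connected_moves p)"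
    using 2(2) by (cases "connected_moves p") auto
  then show ?case
  proof (intro breaker_wins.maker[OF 2(3)])
    fix m assume "connected_legal_move hub_graph 3 p m"
    then have m: "m \<in> set (connected_moves p)" by (simp add: in_connected_moves_iff)
    then consider "is_stuck (p @ [m])"
      | m' where "m' \<in> set (connected_moves (p @ [m]))"
          "is_stuck (p @ [m, m']) \<or> trapped n (p @ [m, m'])"
      using 2(2) by (auto simp: list_all_iff list_ex_iff)
    then show "breaker_wins_connected (p @ [m])"
    proof cases
      case (2 m')
      then show ?thesis
        using "2.IH"[OF m 2(1)] "2.prems"(2) breaker_reply[of "p @ [m]" m']
          is_stuck_imp_breaker_wins[of "p @ [m, m']"]
        by auto
    qed (rule is_stuck_imp_breaker_wins)
  qed (simp add: in_connected_moves_iff)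
qed

text \<open>
  Breaker's reply to an opening at \<open>v\<close> is at index \<open>v\<close> of the list, in a colour other than the one
  that Maker has used. After all openings but \<open>8\<close>, every answer of Maker blocks a vertex or
  permits an immediate kill. After \<open>8\<close> and the reply \<open>6\<close>, Maker can last one round longer by giving \<open>3\<close> or \<open>4\<close> the colour of
  \<open>6\<close>, and then Breaker gives this colour to the other of the two.
\<close>

lemma opening_replies:
  "list_all (\<lambda>(v, c). let m = ([7, 3, 6, 1, 1, 1, 2, 0, 6] ! v, (c + 1) mod 3) in
     m \<in> set (connected_moves [(v, c)]) \<and> trapped (if v = 8 then 2 else 1) [(v, c), m])
   (connected_moves [])"
  by code_simp

lemma breaker_wins_hub_graph: "breaker_wins_connected []"
proof (rule breaker_wins.maker)
  show "connected_legal_move hub_graph 3 [] (0, 0)"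
    by (simp add: connected_legal_move_def legal_move_def)
  fix m assume "connected_legal_move hub_graph 3 [] m"
  then obtain m' n where "m' \<in> set (connected_moves [m])" "trapped n [m, m']"
    using opening_replies by (cases m) (force simp: list_all_iff in_connected_moves_iff Let_def)
  then show "breaker_wins_connected ([] @ [m])"
    using breaker_reply[of "[m]" m'] trapped_imp_breaker_wins[of n "[m, m']"] by simp
qed simp

section \<open>The two game chromatic numbers differ\<close>

theorem theorem4p1:
  shows "\<exists>G :: nat pair_pre_digraph. pair_graph G \<and> connected G \<and>
    game_chromatic_number G < connected_game_chromatic_number G"
proof (intro exI conjI)
  let ?wins = "\<lambda>k s. winning_strategy hub_graph k (connected_legal_move hub_graph k) s"
  have legal: "legal_move hub_graph k p m" if "connected_legal_move hub_graph k p m" for k p m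
    using that by (simp add: connected_legal_move_def)
  have "game_chromatic_number hub_graph \<le> 3"
    unfolding game_chromatic_number_def
    by (intro Least_le maker_wins_imp_winning_strategy maker_wins_hub_graph)
  also have "3 < connected_game_chromatic_number hub_graph"
  proof -
    let ?k = "connected_game_chromatic_number hub_graph"
    have "\<exists>s. ?wins ?k s"
      unfolding connected_game_chromatic_number_def
      by (rule LeastI_ex) (use connected_game_winnable[OF pair_graph_hub_graph connected_hub_graph] in blast)
    then obtain s where s: "?wins ?k s" ..
    have "3 \<le> ?k"
      by (rule triangle_needs_three_colours[OF pair_graph_hub_graph s, of 0 1 3])
        (use legal in \<open>simp_all add: neighbours_def\<close>)
    moreover have "\<not> ?wins 3 s" for s
      using breaker_wins_imp_not_winning_strategy[OF breaker_wins_hub_graph play_following.start legal] .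
    ultimately show ?thesis using s by (cases "?k = 3") auto
  qed
  finally show "game_chromatic_number hub_graph < connected_game_chromatic_number hub_graph" .
qed (rule pair_graph_hub_graph connected_hub_graph)+

end
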